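(* For all integers $n>k\ge 3$, the graph $G_{k,n}$ defined in the context is $\mathcal{F}'_k$-saturated and has $n$ vertices and $\rho_k(n)$ edges, where $$\rho_k(n)=(k-1)(n-1)-\left\lfloor\frac{n}{k+1}\right\rfloor\binom{k-1}{2}.$$
   Context: All graphs are finite and simple (no loops or multiedges). For a positive integer $k$, $\mathcal{F}'_k$ is the family of $k$-edge-connected graphs; a $k$-edge-connected graph is a graph with at least two vertices that remains connected after deletion of any set of fewer than $k$ edges (so a single vertex is not in $\mathcal{F}'_k$). Given a family $\mathcal{F}$ of graphs, a graph $G$ is $\mathcal{F}$-saturated if (1) no subgraph of $G$ belongs to $\mathcal{F}$, and (2) for every edge $e$ of the complement $\overline{G}$, the graph $G+e$ contains a subgraph belonging to $\mathcal{F}$. $K_{k+1}^-$ denotes the graph obtained from the complete graph $K_{k+1}$ by deleting one edge, and $[m]=\{1,\dots,m\}$. Definition of $G_{k,n}$ for $k\ge 3$ and $n>k$: let $t=\lfloor n/(k+1)\rfloor$ and $r=n-t(k+1)$. For $i\in[t]$, let $H_i$ be a copy of $K_{k+1}^-$ on vertices $u_{i,1},\dots,u_{i,k+1}$, in which $u_{i,1}$ and $u_{i,k+1}$ are the nonadjacent pair. Let $F_t$ be obtained from the disjoint union $H_1+\cdots+H_t$ by adding the edge $u_{i,j}u_{i+1,j}$ for all $i\in[t-1]$ and all $j\in[k+1]\setminus\{2,k\}$. Then $G_{k,n}$ is obtained from $F_t$ by adding $r$ new vertices $w_1,\dots,w_r$, each having neighborhood exactly $V(H_t)\setminus\{u_{t,1},u_{t,k+1}\}$.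 *)

theory Defs
  imports Main
begin

datatype 'a graph = Graph (verts: "'a set") (edges: "'a set set")

definition simple_graph :: "'a graph \<Rightarrow> bool" where
  "simple_graph G \<longleftrightarrow> finite (verts G) \<and> (\<forall>e \<in> edges G. e \<subseteq> verts G \<and> card e = 2)"

definition subgraph :: "'a graph \<Rightarrow> 'a graph \<Rightarrow> bool" where
  "subgraph H G \<longleftrightarrow> simple_graph H \<and> verts H \<subseteq> verts G \<and> edges H \<subseteq> edges G"

definition complete_graph :: "'a set \<Rightarrow> 'a graph" where
  "complete_graph V = Graph V {e. e \<subseteq> V \<and> card e = 2}"

definition complement :: "'a graph \<Rightarrow> 'a graph" where
  "complement G = Graph (verts G) (edges (complete_graph (verts G)) - edges G)"

definition add_edge :: "'a graph \<Rightarrow> 'a set \<Rightarrow> 'a graph" where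
  "add_edge G e = Graph (verts G) (insert e (edges G))"

definition delete_edges :: "'a graph \<Rightarrow> 'a set set \<Rightarrow> 'a graph" where
  "delete_edges G D = Graph (verts G) (edges G - D)"

definition adjacency :: "'a graph \<Rightarrow> ('a \<times> 'a) set" where
  "adjacency G = {(u, v). {u, v} \<in> edges G}"

definition connected_graph :: "'a graph \<Rightarrow> bool" where
  "connected_graph G \<longleftrightarrow>
     verts G \<noteq> {} \<and> (\<forall>u \<in> verts G. \<forall>v \<in> verts G. (u, v) \<in> (adjacency G)\<^sup>*)"

definition edge_connected :: "nat \<Rightarrow> 'a graph \<Rightarrow> bool" where
  "edge_connected k G \<longleftrightarrow> simple_graph G \<and> 2 \<le> card (verts G) \<and>
     (\<forall>D \<subseteq> edges G. card D < k \<longrightarrow> connected_graph (delete_edges G D))"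

definition edge_connected_family :: "nat \<Rightarrow> 'a graph set" where
  "edge_connected_family k = {G. edge_connected k G}"

text \<open>
  A subgraph of \<open>G\<close> lives on the vertex type of \<open>G\<close>, so membership in \<open>\<F>\<close> is literal
  membership; this agrees with containment up to isomorphism whenever \<open>\<F>\<close> is closed under
  isomorphism, as \<open>edge_connected_family k\<close> is.
\<close>

definition saturated :: "'a graph set \<Rightarrow> 'a graph \<Rightarrow> bool" where
  "saturated \<F> G \<longleftrightarrow> simple_graph G \<and>
     \<not> (\<exists>H \<in> \<F>. subgraph H G) \<and>
     (\<forall>e \<in> edges (complement G). \<exists>H \<in> \<F>. subgraph H (add_edge G e))"

text \<open>
  \<open>U i j\<close> is the vertex $u_{i,j}$ and \<open>W l\<close> is $w_l$, with indices starting at 1;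
  distinctness of constructors makes the graphs $H_i$ and the $w_l$ disjoint.
\<close>

datatype vertex = U nat nat | W nat

definition H_graph :: "nat \<Rightarrow> nat \<Rightarrow> vertex graph" where
  "H_graph k i = delete_edges (complete_graph (U i ` {1..k+1})) {{U i 1, U i (k+1)}}"

definition F_graph :: "nat \<Rightarrow> nat \<Rightarrow> vertex graph" where
  "F_graph k t = Graph
     (\<Union>i\<in>{1..t}. verts (H_graph k i))
     ((\<Union>i\<in>{1..t}. edges (H_graph k i)) \<union>
      {{U i j, U (i+1) j} | i j. i \<in> {1..<t} \<and> j \<in> {1..k+1} - {2, k}})"

definition G_graph :: "nat \<Rightarrow> nat \<Rightarrow> vertex graph" where
  "G_graph k n =
     (let t = n div (k+1); r = n - t * (k+1) in
      Graph
        (verts (F_graph k t) \<union> W ` {1..r})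
        (edges (F_graph k t) \<union>
         {{W l, x} | l x. l \<in> {1..r} \<and> x \<in> verts (H_graph k t) - {U t 1, U t (k+1)}}))"

definition rho :: "nat \<Rightarrow> nat \<Rightarrow> int" where
  "rho k n = (int k - 1) * (int n - 1) - int (n div (k+1)) * int ((k-1) choose 2)"

end

theory Submission
  imports Defs
begin

text \<open>
  Edge connectivity is handled through cuts: a graph is \<open>k\<close>-edge-connected exactly when every vertex
  set that separates its vertices is crossed by at least \<open>k\<close> edges (\<open>edge_connected_iff_cuts\<close>).
  The graph \<open>G_graph k n\<close> is a chain of blocks $K_{k+1}^-$ in which each block is joined to the next
  by only \<open>k - 1\<close> \<^emph>\<open>rungs\<close>, with pendant vertices \<open>W l\<close> of degree \<open>k - 1\<close> at the last block. The two
  nonadjacent vertices of a block are called its \<^emph>\<open>poles\<close>, the other \<open>k - 1\<close> vertices its \<^emph>\<open>core\<close>.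

  No subgraph is \<open>k\<close>-edge-connected, since such a subgraph cannot be crossed by fewer than \<open>k\<close> edges.
  It therefore avoids the vertices \<open>W l\<close>, does not cross any bundle of rungs, and so lies in a single
  block; within a block the poles have degree \<open>k - 1\<close>, and the core alone is too small
  (\<open>tailed_chain_no_edge_connected_subgraph\<close>).

  Adding a missing edge creates a \<open>k\<close>-edge-connected subgraph for one of two reasons. If its ends
  behave like poles of one common core, which for the last block includes the vertices \<open>W l\<close>,
  then core and ends form a $K_{k+1}$ (\<open>missing_edge_between_poles\<close>). Otherwise the edge closes the
  stretch of the chain between its two ends to a ring (\<open>missing_edge_closes_chain\<close>). If a cut splits no
  block of that ring, it crosses the ring in at least two places, one of which may be the new edge,
  while every other one is a bundle of \<open>k - 1\<close> edges (\<open>cyclic_chain_cut\<close>). If it splits a block, it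
  contains \<open>k - 1\<close> edges of that block, and even \<open>k\<close> unless it separates the poles
  (\<open>H_graph_cut\<close>). If it does separate them, a neighbouring block supplies one more edge: either that
  block is split as well, or one of the two rungs at the poles is cut. The indices without a rung, 2
  and \<open>k\<close>, belong to the core, so each pole does have a rung to that block.

  The counts hold because blocks, rung bundles and spoke bundles are pairwise disjoint.
\<close>

section \<open>Edge connectivity in terms of cuts\<close>

definition edge_cut :: "'a graph \<Rightarrow> 'a set \<Rightarrow> 'a set set" where
  "edge_cut G S = {e \<in> edges G. e \<inter> S \<noteq> {} \<and> \<not> e \<subseteq> S}"

lemma finite_edges: "simple_graph G \<Longrightarrow> finite (edges G)"
  unfolding simple_graph_def by (rule finite_subset[of _ "Pow (verts G)"]) auto

lemma edge_cut_mono: "edges G \<subseteq> edges H \<Longrightarrow> edge_cut G S \<subseteq> edge_cut H S"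
  by (auto simp: edge_cut_def)

lemma edge_cut_subset: "edge_cut G S \<subseteq> edges G"
  by (auto simp: edge_cut_def)

text \<open>
  If deleting \<open>D\<close> disconnects \<open>G\<close>, the set reachable from one vertex has all its crossing edges in
  \<open>D\<close>; conversely the crossing edges of a separating set are themselves a disconnecting deletion.
  Quantifying over sets \<open>S\<close> that may reach outside \<open>G\<close> lets one \<open>S\<close> serve for a graph and for its
  subgraphs.
\<close>

lemma edge_connected_iff_cuts:
  assumes "simple_graph G" "2 \<le> card (verts G)"
  shows "edge_connected k G \<longleftrightarrow>
    (\<forall>S. verts G \<inter> S \<noteq> {} \<and> \<not> verts G \<subseteq> S \<longrightarrow> k \<le> card (edge_cut G S))"
proof (intro iffI allI impI)
  fix S assume ec: "edge_connected k G" and S: "verts G \<inter> S \<noteq> {} \<and> \<not> verts G \<subseteq> S"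
  show "k \<le> card (edge_cut G S)"
  proof (rule ccontr)
    assume "\<not> k \<le> card (edge_cut G S)"
    then have conn: "connected_graph (delete_edges G (edge_cut G S))"
      using ec edge_cut_subset[of G S] by (auto simp: edge_connected_def)
    obtain u v where uv: "u \<in> verts G" "u \<in> S" "v \<in> verts G" "v \<notin> S" using S by blast
    then have "(u, v) \<in> (adjacency (delete_edges G (edge_cut G S)))\<^sup>*"
      using conn by (auto simp: connected_graph_def delete_edges_def)
    then have "v \<in> S"
      by (induction rule: rtrancl_induct)
        (use uv in \<open>auto simp: adjacency_def delete_edges_def edge_cut_def\<close>)
    then show False using uv by blast
  qed
next
  assume cuts: "\<forall>S. verts G \<inter> S \<noteq> {} \<and> \<not> verts G \<subseteq> S \<longrightarrow> k \<le> card (edge_cut G S)"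
  show "edge_connected k G"
    unfolding edge_connected_def
  proof (intro conjI allI impI assms)
    fix D assume D: "D \<subseteq> edges G" "card D < k"
    let ?A = "(adjacency (delete_edges G D))\<^sup>*"
    have "(u, v) \<in> ?A" if uv: "u \<in> verts G" "v \<in> verts G" for u v
    proof (rule ccontr)
      assume nr: "(u, v) \<notin> ?A"
      define S where "S = {x. (u, x) \<in> ?A}"
      have "edge_cut G S \<subseteq> D"
      proof
        fix e assume e: "e \<in> edge_cut G S"
        then obtain x y where xy: "x \<in> e" "x \<in> S" "y \<in> e" "y \<notin> S"
          by (auto simp: edge_cut_def)
        have "card e = 2" using e assms(1) by (auto simp: edge_cut_def simple_graph_def)
        then have "e = {x, y}" using xy by (auto simp: card_2_iff)
        then show "e \<in> D"
          using xy e by (auto simp: S_def adjacency_def delete_edges_def edge_cut_def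
              intro: rtrancl_into_rtrancl)
      qed
      then have "card (edge_cut G S) \<le> card D"
        using D finite_edges[OF assms(1)] by (meson card_mono finite_subset)
      moreover have "u \<in> S" "v \<notin> S" using nr by (auto simp: S_def)
      ultimately show False using cuts uv D(2) by fastforce
    qed
    moreover have "verts G \<noteq> {}" using assms(2) by auto
    ultimately show "connected_graph (delete_edges G D)"
      by (auto simp: connected_graph_def delete_edges_def)
  qed
qed

text \<open>
  This confines a \<open>k\<close>-edge-connected subgraph to one side of a small cut of the ambient graph.
\<close>

lemma edge_connected_small_cut:
  assumes "edge_connected k H" "edge_cut H S \<subseteq> C" "finite C" "card C < k" "verts H \<inter> S \<noteq> {}"
  shows "verts H \<subseteq> S"
proof (rule ccontr)
  assume "\<not> verts H \<subseteq> S"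
  then have "k \<le> card (edge_cut H S)"
    using assms edge_connected_iff_cuts[of H k] by (auto simp: edge_connected_def)
  then show False using card_mono[OF assms(3,2)] assms(4) by linarith
qed

lemma edge_connected_small_degree:
  assumes H: "edge_connected k H"
    and nb: "\<And>e. e \<in> edges H \<Longrightarrow> x \<in> e \<Longrightarrow> \<exists>y\<in>N. e = {x, y}"
    and N: "finite N" "card N < k"
  shows "x \<notin> verts H"
proof
  assume x: "x \<in> verts H"
  have "edge_cut H {x} \<subseteq> (\<lambda>y. {x, y}) ` N"
    using nb by (auto simp: edge_cut_def)
  moreover have "card ((\<lambda>y. {x, y}) ` N) < k"
    using card_image_le[OF N(1), of "\<lambda>y. {x, y}"] N(2) by linarith
  ultimately have "verts H \<subseteq> {x}"
    using edge_connected_small_cut[OF H] N(1) x by blast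
  then have "card (verts H) \<le> 1" using card_mono[of "{x}" "verts H"] by simp
  then show False using H by (simp add: edge_connected_def)
qed

lemma simple_complete_graph: "finite B \<Longrightarrow> simple_graph (complete_graph B)"
  by (auto simp: simple_graph_def complete_graph_def)

text \<open>
  With \<open>p\<close> vertices on one side and \<open>q\<close> on the other the cut has \<open>p * q\<close> edges, and
  \<open>(p - 1) * (q - 1) \<ge> 0\<close> bounds this below by \<open>p + q - 1\<close>.
\<close>

lemma card_complete_cut:
  assumes "finite B" "B \<inter> S \<noteq> {}" "\<not> B \<subseteq> S"
  shows "card B - 1 \<le> card (edge_cut (complete_graph B) S)"
proof -
  let ?A = "B \<inter> S" and ?C = "B - S"
  let ?f = "\<lambda>(x, y). {x, y}"
  have "?f ` (?A \<times> ?C) \<subseteq> edge_cut (complete_graph B) S"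
    by (auto simp: edge_cut_def complete_graph_def card_2_iff)
  moreover have "inj_on ?f (?A \<times> ?C)"
    by (auto simp: inj_on_def doubleton_eq_iff)
  moreover have "finite (edge_cut (complete_graph B) S)"
    using finite_edges[OF simple_complete_graph[OF assms(1)]] edge_cut_subset
    by (rule finite_subset[rotated])
  ultimately have "card (?A \<times> ?C) \<le> card (edge_cut (complete_graph B) S)"
    by (metis card_image card_mono)
  then have prod: "card ?A * card ?C \<le> card (edge_cut (complete_graph B) S)"
    by (simp add: card_cartesian_product)
  have sum: "card B = card ?A + card ?C"
    using assms(1) by (subst card_Un_disjoint[symmetric]) (auto intro: arg_cong[of _ _ card])
  have pos: "1 \<le> card ?A" "1 \<le> card ?C"
    using assms by (auto simp: Suc_le_eq card_gt_0_iff)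
  have "p + q - 1 \<le> p * q" if "1 \<le> p" "1 \<le> q" for p q :: nat
    using that by (cases p; cases q; simp)
  from this[OF pos] show ?thesis using prod sum by linarith
qed

lemma complete_graph_edge_connected:
  assumes "finite B" "card B = k + 1" "1 \<le> k"
  shows "edge_connected k (complete_graph B)"
proof -
  have "verts (complete_graph B) = B" by (simp add: complete_graph_def)
  then show ?thesis
    using assms card_complete_cut[OF assms(1)]
    by (subst edge_connected_iff_cuts[OF simple_complete_graph]) auto
qed

section \<open>Cuts of a cyclic chain of parts\<close>

lemma change_between:
  fixes Q :: "nat \<Rightarrow> bool"
  assumes "i \<le> m" "Q i \<noteq> Q m"
  shows "\<exists>a\<in>{i..<m}. Q a \<noteq> Q (Suc a)"
  using assms
proof (induction m rule: dec_induct)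
  case (step m)
  show ?case
  proof (cases "Q i = Q m")
    case True
    then have "Q m \<noteq> Q (Suc m)" using step.prems by blast
    then show ?thesis using step.hyps by (intro bexI[of _ m]) simp_all
  next
    case False
    then obtain a where "a \<in> {i..<m}" "Q a \<noteq> Q (Suc a)" using step.IH by blast
    then show ?thesis by (intro bexI[of _ a]) simp_all
  qed
qed simp

text \<open>
  The parts \<open>P i, \<dots>, P m\<close> form a ring: consecutive parts are joined by bundles \<open>R a\<close> of \<open>k - 1\<close> edges,
  and a single further edge joins the last part to the first. A set that is a union of some but not
  all parts changes sides at least twice around the ring. Two bundles contribute \<open>2 * (k - 1)\<close> edges,
  which is at least \<open>k\<close>, and a bundle together with the closing edge contributes \<open>k\<close>.
\<close>

lemma cyclic_chain_cut:
  fixes P :: "nat \<Rightarrow> 'a set" and R :: "nat \<Rightarrow> 'a set set"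
  assumes k: "3 \<le> k" and fin: "finite (edges G)"
    and rung: "\<And>a. a \<in> {i..<m} \<Longrightarrow> R a \<subseteq> edges G \<and> k - 1 \<le> card (R a)"
    and ends: "\<And>a f. a \<in> {i..<m} \<Longrightarrow> f \<in> R a \<Longrightarrow>
      f \<subseteq> P a \<union> P (Suc a) \<and> f \<inter> P a \<noteq> {} \<and> f \<inter> P (Suc a) \<noteq> {}"
    and e: "{x, y} \<in> edges G" "x \<in> P i" "y \<in> P m" "\<And>a. a \<in> {i..<m} \<Longrightarrow> {x, y} \<notin> R a"
    and disj: "\<And>a b. a \<in> {i..m} \<Longrightarrow> b \<in> {i..m} \<Longrightarrow> a \<noteq> b \<Longrightarrow> P a \<inter> P b = {}"
    and whole: "\<And>a. a \<in> {i..m} \<Longrightarrow> P a \<subseteq> S \<or> P a \<inter> S = {}"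
    and split: "b \<in> {i..m}" "c \<in> {i..m}" "P b \<subseteq> S" "\<not> P c \<subseteq> S"
  shows "k \<le> card (edge_cut G S)"
proof -
  let ?Q = "\<lambda>a. P a \<subseteq> S"
  have fincut: "finite (edge_cut G S)" using fin edge_cut_subset by (rule finite_subset[rotated])
  have R_cut: "R a \<subseteq> edge_cut G S" if "a \<in> {i..<m}" "?Q a \<noteq> ?Q (Suc a)" for a
  proof
    fix f assume f: "f \<in> R a"
    have "P a \<subseteq> S \<or> P a \<inter> S = {}" "P (Suc a) \<subseteq> S \<or> P (Suc a) \<inter> S = {}"
      using whole that(1) by auto
    then show "f \<in> edge_cut G S"
      using ends[OF that(1) f] rung[OF that(1)] f that(2) by (auto simp: edge_cut_def)
  qed
  show ?thesis
  proof (cases "?Q i = ?Q m")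
    case False
    then obtain a where a: "a \<in> {i..<m}" "?Q a \<noteq> ?Q (Suc a)"
      using change_between[of i m ?Q] split(1) by (meson atLeastAtMost_iff le_trans)
    have "{x, y} \<in> edge_cut G S"
      using False e whole[of i] whole[of m] split by (auto simp: edge_cut_def)
    then have "insert {x, y} (R a) \<subseteq> edge_cut G S" using R_cut[OF a] by blast
    then have "card (insert {x, y} (R a)) \<le> card (edge_cut G S)" using fincut by (rule card_mono[rotated])
    moreover have "finite (R a)" using rung[OF a(1)] fin finite_subset by blast
    ultimately have "Suc (card (R a)) \<le> card (edge_cut G S)" using e(4)[OF a(1)] by simp
    then show ?thesis using rung[OF a(1)] by linarith
  next
    case True
    \<comment> \<open>Both ends are on the same side, so there is a change of side before \<open>d\<close> and another after.\<close>
    obtain d where d: "d \<in> {i..m}" "?Q d \<noteq> ?Q i" using split by blast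
    then obtain a where a: "a \<in> {i..<d}" "?Q a \<noteq> ?Q (Suc a)"
      using change_between[of i d ?Q] by (metis atLeastAtMost_iff)
    obtain a' where a': "a' \<in> {d..<m}" "?Q a' \<noteq> ?Q (Suc a')"
      using change_between[of d m ?Q] d True by (metis atLeastAtMost_iff)
    have am: "a \<in> {i..<m}" "a' \<in> {i..<m}" "a < a'" using a a' d by auto
    have "R a \<inter> R a' = {}"
    proof (rule ccontr)
      assume "R a \<inter> R a' \<noteq> {}"
      then obtain f where "f \<in> R a" "f \<in> R a'" by blast
      then have "(P a \<union> P (Suc a)) \<inter> P (Suc a') \<noteq> {}"
        using ends[OF am(1)] ends[OF am(2)] by blast
      then show False using disj[of a "Suc a'"] disj[of "Suc a" "Suc a'"] am
        by (simp add: Int_Un_distrib2)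
    qed
    moreover have "finite (R a)" "finite (R a')"
      using rung[OF am(1)] rung[OF am(2)] fin finite_subset by blast+
    ultimately have "card (R a \<union> R a') = card (R a) + card (R a')" by (simp add: card_Un_disjoint)
    moreover have "card (R a \<union> R a') \<le> card (edge_cut G S)"
      using R_cut[OF am(1) a(2)] R_cut[OF am(2) a'(2)] fincut by (intro card_mono) auto
    ultimately show ?thesis using rung[OF am(1)] rung[OF am(2)] k by linarith
  qed
qed

section \<open>The chain of blocks and its pendant vertices\<close>

definition block :: "nat \<Rightarrow> nat \<Rightarrow> vertex set" where
  "block k a = U a ` {1..k+1}"

definition core :: "nat \<Rightarrow> nat \<Rightarrow> vertex set" where
  "core k a = U a ` {2..k}"

definition rungs :: "nat \<Rightarrow> nat \<Rightarrow> vertex set set" where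
  "rungs k a = (\<lambda>j. {U a j, U (Suc a) j}) ` ({1..k+1} - {2, k})"

definition spokes :: "nat \<Rightarrow> nat \<Rightarrow> nat \<Rightarrow> vertex set set" where
  "spokes k t l = (\<lambda>x. {W l, x}) ` core k t"

text \<open>
  The graph \<open>G_graph k n\<close> with the number \<open>t\<close> of blocks and the number \<open>r\<close> of pendant vertices as
  independent parameters, so that the structural arguments are free of division.
\<close>

definition tailed_chain :: "nat \<Rightarrow> nat \<Rightarrow> nat \<Rightarrow> vertex graph" where
  "tailed_chain k t r = Graph
     ((\<Union>a\<in>{1..t}. block k a) \<union> W ` {1..r})
     ((\<Union>a\<in>{1..t}. edges (H_graph k a)) \<union> (\<Union>a\<in>{1..<t}. rungs k a) \<union>
      (\<Union>l\<in>{1..r}. spokes k t l))"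

lemma verts_H_graph: "verts (H_graph k a) = block k a"
  by (simp add: H_graph_def block_def delete_edges_def complete_graph_def)

lemma edges_H_graph:
  "edges (H_graph k a) = {e. e \<subseteq> block k a \<and> card e = 2} - {{U a 1, U a (k+1)}}"
  by (simp add: H_graph_def block_def delete_edges_def complete_graph_def)

lemma core_eq: "core k a = block k a - {U a 1, U a (k+1)}"
  by (auto simp: core_def block_def)

lemma G_graph_eq: "G_graph k n = tailed_chain k (n div (k+1)) (n mod (k+1))"
proof -
  let ?t = "n div (k+1)" and ?r = "n mod (k+1)"
  have r: "n - ?t * (k+1) = ?r"
    by (rule minus_div_mult_eq_mod)
  have 1: "{{U i j, U (i+1) j} | i j. i \<in> {1..<?t} \<and> j \<in> {1..k+1} - {2, k}} =
      (\<Union>a\<in>{1..<?t}. rungs k a)"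
    unfolding rungs_def by (simp only: Suc_eq_plus1) blast
  have 2: "{{W l, x} | l x. l \<in> {1..?r} \<and> x \<in> core k ?t} = (\<Union>l\<in>{1..?r}. spokes k ?t l)"
    unfolding spokes_def by blast
  show ?thesis
    unfolding G_graph_def Let_def r F_graph_def tailed_chain_def verts_H_graph core_eq[symmetric]
      graph.sel 1 2 by (simp add: Un_assoc)
qed

lemma finite_block: "finite (block k a)" and card_block: "card (block k a) = k + 1"
  by (auto simp: block_def card_image inj_on_def)

lemma finite_core: "finite (core k a)" and card_core: "card (core k a) = k - 1"
  by (auto simp: core_def card_image inj_on_def)

lemma finite_H_edges: "finite (edges (H_graph k a))"
  by (rule finite_subset[of _ "Pow (block k a)"]) (auto simp: edges_H_graph finite_block)

lemma finite_rungs: "finite (rungs k a)" by (simp add: rungs_def)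

lemma card_rungs: "3 \<le> k \<Longrightarrow> card (rungs k a) = k - 1"
  unfolding rungs_def
  by (subst card_image) (auto simp: inj_on_def doubleton_eq_iff card_Diff_subset)

lemma finite_spokes: "finite (spokes k t l)" by (simp add: spokes_def finite_core)

lemma card_spokes: "card (spokes k t l) = k - 1"
  unfolding spokes_def
  by (subst card_image) (auto simp: inj_on_def doubleton_eq_iff card_core)

lemma simple_tailed_chain:
  assumes "1 \<le> t"
  shows "simple_graph (tailed_chain k t r)"
  unfolding simple_graph_def
proof (intro conjI ballI)
  show "finite (verts (tailed_chain k t r))" by (simp add: tailed_chain_def finite_block)
  fix e assume "e \<in> edges (tailed_chain k t r)"
  then consider a where "a \<in> {1..t}" "e \<in> edges (H_graph k a)"
    | a where "a \<in> {1..<t}" "e \<in> rungs k a" | l where "l \<in> {1..r}" "e \<in> spokes k t l"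
    by (auto simp: tailed_chain_def)
  then have "e \<subseteq> verts (tailed_chain k t r) \<and> card e = 2"
  proof cases
    case 1 then show ?thesis by (auto simp: edges_H_graph tailed_chain_def)
  next
    case 2
    then have "block k a \<subseteq> verts (tailed_chain k t r)" "block k (Suc a) \<subseteq> verts (tailed_chain k t r)"
      by (fastforce simp: tailed_chain_def)+
    then show ?thesis using 2 by (auto simp: rungs_def block_def)
  next
    case 3
    have "block k t \<subseteq> verts (tailed_chain k t r)" using assms
      by (fastforce simp: tailed_chain_def)
    moreover have "core k t \<subseteq> block k t" by (auto simp: core_eq)
    moreover have "W l \<in> verts (tailed_chain k t r)" using 3 by (simp add: tailed_chain_def)
    ultimately show ?thesis using 3 by (auto simp: spokes_def core_def)
  qed
  then show "e \<subseteq> verts (tailed_chain k t r)" "card e = 2" by auto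
qed

section \<open>Vertex and edge counts\<close>

lemma card_verts_tailed_chain: "card (verts (tailed_chain k t r)) = t * (k + 1) + r"
proof -
  have "card (\<Union>a\<in>{1..t}. block k a) = (\<Sum>a\<in>{1..t}. card (block k a))"
    by (rule card_UN_disjoint) (auto simp: block_def)
  moreover have "card (W ` {1..r}) = r" by (simp add: card_image inj_on_def)
  moreover have "(\<Union>a\<in>{1..t}. block k a) \<inter> W ` {1..r} = {}" by (auto simp: block_def)
  ultimately show ?thesis
    by (simp add: tailed_chain_def card_Un_disjoint finite_block card_block)
qed

lemma card_edges_H_graph: "1 \<le> k \<Longrightarrow> card (edges (H_graph k a)) = (k + 1 choose 2) - 1"
  unfolding edges_H_graph
  by (subst card_Diff_subset) (auto simp: n_subsets finite_block card_block, auto simp: block_def)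

lemma card_edges_tailed_chain:
  assumes "3 \<le> k" "1 \<le> t"
  shows "card (edges (tailed_chain k t r)) =
    t * ((k + 1 choose 2) - 1) + (t - 1) * (k - 1) + r * (k - 1)"
proof -
  let ?A = "\<Union>a\<in>{1..t}. edges (H_graph k a)" and ?B = "\<Union>a\<in>{1..<t}. rungs k a"
    and ?C = "\<Union>l\<in>{1..r}. spokes k t l"
  have "card ?A = (\<Sum>a\<in>{1..t}. card (edges (H_graph k a)))"
  proof (rule card_UN_disjoint)
    show "\<forall>i\<in>{1..t}. \<forall>j\<in>{1..t}. i \<noteq> j \<longrightarrow> edges (H_graph k i) \<inter> edges (H_graph k j) = {}"
      by (auto simp: edges_H_graph block_def card_2_iff)
  qed (auto simp: finite_H_edges)
  then have A: "card ?A = t * ((k + 1 choose 2) - 1)" using assms by (simp add: card_edges_H_graph)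
  have "card ?B = (\<Sum>a\<in>{1..<t}. card (rungs k a))"
  proof (rule card_UN_disjoint)
    show "\<forall>i\<in>{1..<t}. \<forall>j\<in>{1..<t}. i \<noteq> j \<longrightarrow> rungs k i \<inter> rungs k j = {}"
    proof (intro ballI impI, rule ccontr)
      fix i j :: nat assume "i \<noteq> j" "rungs k i \<inter> rungs k j \<noteq> {}"
      then obtain f where f: "f \<in> rungs k i" "f \<in> rungs k j" by blast
      \<comment> \<open>A rung determines the two levels that it joins.\<close>
      have level: "(\<exists>c. U b c \<in> f) \<longleftrightarrow> b = a \<or> b = Suc a" if "f \<in> rungs k a" for a b
        using that by (auto simp: rungs_def)
      have "i = j \<or> i = Suc j" "j = i \<or> j = Suc i"
        using level[OF f(1)] level[OF f(2)] by metis+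
      then show False using \<open>i \<noteq> j\<close> by linarith
    qed
  qed (auto simp: finite_rungs)
  then have B: "card ?B = (t - 1) * (k - 1)" using assms by (simp add: card_rungs)
  have "card ?C = (\<Sum>l\<in>{1..r}. card (spokes k t l))"
  proof (rule card_UN_disjoint)
    show "\<forall>i\<in>{1..r}. \<forall>j\<in>{1..r}. i \<noteq> j \<longrightarrow> spokes k t i \<inter> spokes k t j = {}"
      by (auto simp: spokes_def core_def doubleton_eq_iff)
  qed (auto simp: finite_spokes)
  then have C: "card ?C = r * (k - 1)" by (simp add: card_spokes)
  have "edges (H_graph k a) \<inter> rungs k b = {}" for a b
  proof (rule ccontr)
    assume "\<not> ?thesis"
    then obtain f where f: "f \<subseteq> block k a" "f \<in> rungs k b" by (auto simp: edges_H_graph)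
    obtain j where "U b j \<in> f" "U (Suc b) j \<in> f" using f(2) by (auto simp: rungs_def)
    then have "b = a" "Suc b = a" using f(1) by (auto simp: block_def)
    then show False by simp
  qed
  then have "?A \<inter> ?B = {}" by blast
  moreover have "edges (H_graph k a) \<inter> spokes k t l = {}" "rungs k a \<inter> spokes k t l = {}" for a l
  proof -
    have "W l \<in> f" if "f \<in> spokes k t l" for f using that by (auto simp: spokes_def)
    moreover have "W l \<notin> f" if "f \<in> edges (H_graph k a)" for f
      using that by (auto simp: edges_H_graph block_def)
    moreover have "W l \<notin> f" if "f \<in> rungs k a" for f using that by (auto simp: rungs_def)
    ultimately show "edges (H_graph k a) \<inter> spokes k t l = {}" "rungs k a \<inter> spokes k t l = {}"
      by blast+
  qed
  then have "(?A \<union> ?B) \<inter> ?C = {}" by blast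
  ultimately show ?thesis
    using A B C
    by (simp add: tailed_chain_def card_Un_disjoint finite_H_edges finite_rungs finite_spokes)
qed

text \<open>
  The identity rests on \<open>(k + 1 choose 2) - 1 = (k - 1 choose 2) + 2 * (k - 1)\<close>. The natural-number
  subtractions are removed by writing \<open>k = q + 2\<close> and \<open>t = s + 1\<close>.
\<close>

lemma edge_count_eq_rho:
  assumes "3 \<le> k" "k < n"
  defines "t \<equiv> n div (k+1)" and "r \<equiv> n mod (k+1)"
  shows "int (t * ((k + 1 choose 2) - 1) + (t - 1) * (k - 1) + r * (k - 1)) = rho k n"
proof -
  obtain q where q: "k = q + 2" using assms(1) that[of "k - 2"] by simp
  have "1 \<le> t" unfolding t_def using assms(2) by (simp add: Suc_le_eq div_greater_zero_iff)
  then obtain s where s: "t = s + 1" using that[of "t - 1"] by simp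
  have n: "n = t * (k + 1) + r" unfolding t_def r_def by (rule div_mult_mod_eq[symmetric])
  have c: "(k + 1 choose 2) - 1 = (q + 1 choose 2) + 2 * (q + 1)"
    by (simp add: q numeral_2_eq_2)
  have k1: "k - 1 = q + 1" by (simp add: q)
  have "2 * (q + 1 choose 2) = (q + 1) * q" by (simp add: choose_two)
  then have d: "(int q + 1) * int q = 2 * int (q + 1 choose 2)" 
    by (metis of_nat_mult of_nat_Suc Suc_eq_plus1 of_nat_numeral add.commute)
  show ?thesis
    unfolding rho_def t_def[symmetric] c k1 unfolding n
    using d[symmetric] by (simp add: q s algebra_simps)
qed

section \<open>No subgraph is k-edge-connected\<close>

lemma tailed_chain_edge_cases:
  assumes "f \<in> edges (tailed_chain k t r)"
  obtains a where "a \<in> {1..t}" "f \<in> edges (H_graph k a)"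
    | a j where "a \<in> {1..<t}" "f = {U a j, U (Suc a) j}" "f \<in> rungs k a"
    | l x where "l \<in> {1..r}" "x \<in> core k t" "f = {W l, x}"
  using assms by (auto simp: tailed_chain_def spokes_def) (auto simp: rungs_def)

lemma tailed_chain_edge_at_W:
  assumes "f \<in> edges (tailed_chain k t r)" "W l \<in> f"
  shows "\<exists>y\<in>core k t. f = {W l, y}"
  using assms(1)
proof (cases rule: tailed_chain_edge_cases)
  case 1
  then show ?thesis using assms(2) by (auto simp: edges_H_graph block_def)
next
  case 3
  then show ?thesis using assms(2) by (auto simp: core_def)
qed (use assms in auto)

lemma tailed_chain_edge_across:
  assumes "f \<in> edges (tailed_chain k t r)" "\<And>l. W l \<notin> f" "U b j \<in> f" "U c i \<in> f" "b \<le> a" "a < c"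
  shows "f \<in> rungs k a"
  using assms(1)
proof (cases rule: tailed_chain_edge_cases)
  case (1 d)
  then have "b = d" "c = d" using assms by (auto simp: edges_H_graph block_def)
  then show ?thesis using assms by simp
next
  case (2 d j')
  then have "a = d" using assms by auto
  then show ?thesis using 2 by simp
qed (use assms in auto)

lemma tailed_chain_edge_in_block:
  assumes "f \<in> edges (tailed_chain k t r)" "f \<subseteq> block k a"
  shows "f \<in> edges (H_graph k a)"
  using assms(1)
proof (cases rule: tailed_chain_edge_cases)
  case (1 b)
  then have "f \<noteq> {}" "f \<subseteq> block k b" by (auto simp: edges_H_graph)
  then have "a = b" using assms(2) by (fastforce simp: block_def)
  then show ?thesis using 1 by simp
next
  case (2 b j)
  then have "b = a" "Suc b = a" using assms(2) by (auto simp: block_def)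
  then show ?thesis by simp
next
  case 3
  then show ?thesis using assms(2) by (auto simp: block_def)
qed

lemma H_graph_edge_at_pole:
  assumes "f \<in> edges (H_graph k a)" "x \<in> f" "x \<in> {U a 1, U a (k+1)}"
  shows "\<exists>y\<in>core k a. f = {x, y}"
proof -
  have "card f = 2" using assms(1) by (simp add: edges_H_graph)
  then obtain y where y: "f = {x, y}" "y \<noteq> x" using assms(2) by (auto simp: card_2_iff doubleton_eq_iff)
  have "y \<in> block k a" "f \<noteq> {U a 1, U a (k+1)}" using assms(1) y by (auto simp: edges_H_graph)
  then have "y \<in> core k a" using y assms(3) by (auto simp: core_eq doubleton_eq_iff)
  then show ?thesis using y by blast
qed

text \<open>
  A \<open>k\<close>-edge-connected subgraph is confined step by step, each time by a cut of fewer than \<open>k\<close> edges: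
  first to the blocks, then to the lowest block that it meets, then to the core of that block, where
  every vertex has fewer than \<open>k\<close> neighbours.
\<close>

lemma tailed_chain_no_edge_connected_subgraph:
  assumes k: "3 \<le> k" and H: "edge_connected k H" and sub: "subgraph H (tailed_chain k t r)"
  shows False
proof -
  have simp_H: "simple_graph H" using H by (simp add: edge_connected_def)
  have edge: "f \<subseteq> verts H" "card f = 2" "f \<in> edges (tailed_chain k t r)" if "f \<in> edges H" for f
    using that sub simp_H by (auto simp: subgraph_def simple_graph_def)
  have no_W: "W l \<notin> verts H" for l
  proof (rule edge_connected_small_degree[OF H _ finite_core])
    show "card (core k t) < k" using k by (simp add: card_core)
    show "\<exists>y\<in>core k t. f = {W l, y}" if f: "f \<in> edges H" "W l \<in> f" for f
      using tailed_chain_edge_at_W[OF edge(3)[OF f(1)] f(2)] .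
  qed
  have verts_H: "\<exists>b j. x = U b j \<and> x \<in> block k b" if "x \<in> verts H" for x
  proof -
    have "x \<in> verts (tailed_chain k t r)" using that sub by (auto simp: subgraph_def)
    then show ?thesis using no_W that by (auto simp: tailed_chain_def block_def)
  qed
  have "verts H \<noteq> {}" using H by (auto simp: edge_connected_def)
  then have ex: "\<exists>a j. U a j \<in> verts H" using verts_H by blast
  define a where "a = (LEAST a. \<exists>j. U a j \<in> verts H)"
  obtain j where j: "U a j \<in> verts H" using LeastI_ex[OF ex] by (auto simp: a_def)
  have least: "a \<le> b" if "U b i \<in> verts H" for b i
    unfolding a_def by (rule Least_le) (use that in blast)
  let ?S = "{x. \<exists>b i. x = U b i \<and> b \<le> a}"
  \<comment> \<open>Everything up to level \<open>a\<close> is cut off from the rest by the rungs above block \<open>a\<close>.\<close>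
  have "edge_cut H ?S \<subseteq> rungs k a"
  proof
    fix f assume f: "f \<in> edge_cut H ?S"
    then have fH: "f \<in> edges H" by (simp add: edge_cut_def)
    have noW: "W l \<notin> f" for l using edge(1)[OF fH] no_W by blast
    obtain b i y where "U b i \<in> f" "b \<le> a" "y \<in> f" "y \<notin> ?S"
      using f unfolding edge_cut_def by blast
    moreover obtain c i' where "y = U c i'" using noW \<open>y \<in> f\<close> by (cases y) auto
    ultimately show "f \<in> rungs k a"
      using tailed_chain_edge_across[OF edge(3)[OF fH] noW] by auto
  qed
  moreover have "card (rungs k a) < k" using k by (simp add: card_rungs)
  ultimately have "verts H \<subseteq> ?S"
    using edge_connected_small_cut[OF H _ finite_rungs] j by blast
  moreover have "x \<in> block k a" if x: "x \<in> verts H" "x \<in> ?S" for x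
  proof -
    obtain b i where b: "x = U b i" "x \<in> block k b" using verts_H[OF x(1)] by blast
    then have "b = a" using x least[of b i] by auto
    then show ?thesis using b by simp
  qed
  ultimately have in_block: "verts H \<subseteq> block k a" by blast
  have no_pole: "x \<notin> verts H" if x: "x \<in> {U a 1, U a (k+1)}" for x
  proof (rule edge_connected_small_degree[OF H _ finite_core])
    show "card (core k a) < k" using k by (simp add: card_core)
    show "\<exists>y\<in>core k a. f = {x, y}" if f: "f \<in> edges H" "x \<in> f" for f
      using H_graph_edge_at_pole[OF _ f(2) x] edge[OF f(1)] in_block
        tailed_chain_edge_in_block by blast
  qed
  then have in_core: "verts H \<subseteq> core k a" using in_block by (auto simp: core_eq)
  have "U a j \<notin> verts H"
  proof (rule edge_connected_small_degree[OF H _ finite_core])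
    show "card (core k a) < k" using k by (simp add: card_core)
    show "\<exists>y\<in>core k a. f = {U a j, y}" if f: "f \<in> edges H" "U a j \<in> f" for f
      using edge[OF f(1)] f(2) in_core by (auto simp: card_2_iff)
  qed
  then show False using j by blast
qed

section \<open>Every missing edge closes a k-edge-connected subgraph\<close>

text \<open>
  The new edge is the only one missing from the complete graph on the \<open>k + 1\<close> vertices of
  \<open>C\<close>, \<open>x\<close> and \<open>y\<close>.
\<close>

lemma poles_of_core_complete:
  assumes C: "finite C" "card C = k - 1" and k: "1 \<le> k"
    and xy: "x \<noteq> y" "x \<notin> C" "y \<notin> C" "insert x (insert y C) \<subseteq> verts G"
    and core: "\<And>u v. u \<in> C \<Longrightarrow> v \<in> C \<Longrightarrow> u \<noteq> v \<Longrightarrow> {u, v} \<in> edges G"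
    and joined: "\<And>u. u \<in> C \<Longrightarrow> {x, u} \<in> edges G \<and> {y, u} \<in> edges G"
  shows "\<exists>H\<in>edge_connected_family k. subgraph H (add_edge G {x, y})"
proof
  let ?B = "insert x (insert y C)"
  have B: "finite ?B" "card ?B = k + 1" using C k xy by auto
  then show "complete_graph ?B \<in> edge_connected_family k"
    using complete_graph_edge_connected[OF B k] by (simp add: edge_connected_family_def)
  have "e \<in> insert {x, y} (edges G)" if e: "e \<subseteq> ?B" "card e = 2" for e
  proof -
    obtain u v where uv: "e = {u, v}" "u \<noteq> v" using e(2) by (auto simp: card_2_iff)
    then have mem: "u \<in> ?B" "v \<in> ?B" using e by auto
    have uv_edge: "{u, v} \<in> insert {x, y} (edges G)" if "u \<in> C" "v \<in> ?B"
      using that core[of u v] joined[OF that(1)] uv(2) by (metis insert_iff insert_commute)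
    have vu_edge: "{u, v} \<in> insert {x, y} (edges G)" if "v \<in> C" "u \<in> ?B"
      using that core[of u v] joined[OF that(1)] uv(2) by (metis insert_iff insert_commute)
    have "e = {x, y}" if "u \<notin> C" "v \<notin> C" using mem that uv by blast
    then show ?thesis using uv_edge vu_edge mem uv(1) by blast
  qed
  then show "subgraph (complete_graph ?B) (add_edge G {x, y})"
    using simple_complete_graph[OF B(1)] xy(4)
    by (auto simp: subgraph_def add_edge_def complete_graph_def)
qed

text \<open>
  A cut of $K_{k+1}$ has at least \<open>k\<close> edges, and passing to the block loses at most the edge between
  the poles, which is in the cut only if the poles are separated.
\<close>

lemma H_graph_cut:
  assumes "block k a \<inter> S \<noteq> {}" "\<not> block k a \<subseteq> S"
  shows "k - 1 \<le> card (edge_cut (H_graph k a) S)"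
    and "U a 1 \<in> S \<longleftrightarrow> U a (k+1) \<in> S \<Longrightarrow> k \<le> card (edge_cut (H_graph k a) S)"
proof -
  let ?p = "{U a 1, U a (k+1)}"
  have eq: "edge_cut (H_graph k a) S = edge_cut (complete_graph (block k a)) S - {?p}"
    by (auto simp: edge_cut_def edges_H_graph complete_graph_def)
  have card: "k \<le> card (edge_cut (complete_graph (block k a)) S)"
    using card_complete_cut[OF finite_block assms] by (simp add: card_block)
  have "card (edge_cut (complete_graph (block k a)) S) - card {?p} \<le> card (edge_cut (H_graph k a) S)"
    unfolding eq by (rule diff_card_le_card_Diff) simp
  then show "k - 1 \<le> card (edge_cut (H_graph k a) S)" using card by simp
  assume "U a 1 \<in> S \<longleftrightarrow> U a (k+1) \<in> S"
  then have "?p \<notin> edge_cut (complete_graph (block k a)) S" by (auto simp: edge_cut_def)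
  then show "k \<le> card (edge_cut (H_graph k a) S)" using card eq by simp
qed

text \<open>
  The witness is the subgraph induced on the stretch \<open>P i, \<dots>, P m\<close> together with the new edge.
  A pendant vertex is treated as one more part \<open>P (t + 1) = {W l}\<close> at the end of the chain, its spokes
  taking the place of rungs; so both kinds of far end need only one argument. The stretch contains at
  least two blocks, since \<open>i < t\<close>, so every block in it has a neighbouring block.
\<close>

lemma missing_edge_closes_chain:
  fixes P :: "nat \<Rightarrow> vertex set"
  assumes P_def: "P = (\<lambda>a. if a \<le> t then block k a else {W l})"
    and k: "3 \<le> k" and im: "1 \<le> i" "i < m" "i < t" "m \<le> Suc t" and l: "m = Suc t \<Longrightarrow> l \<in> {1..r}"
    and xy: "x \<in> P i" "y \<in> P m" "{x, y} \<notin> edges (tailed_chain k t r)"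
  shows "\<exists>H\<in>edge_connected_family k. subgraph H (add_edge (tailed_chain k t r) {x, y})"
proof
  let ?G = "tailed_chain k t r"
  define V where "V = (\<Union>a\<in>{i..m}. P a)"
  define H where "H = Graph V (insert {x, y} {f \<in> edges ?G. f \<subseteq> V})"
  have disj: "P a \<inter> P b = {}" if "a \<in> {i..m}" "b \<in> {i..m}" "a \<noteq> b" for a b
    using that im by (auto simp: P_def block_def)
  have P_V: "P a \<subseteq> V" if "a \<in> {i..m}" for a using that by (auto simp: V_def)
  have V_G: "V \<subseteq> verts ?G"
    using im l by (fastforce simp: V_def P_def tailed_chain_def split: if_splits)
  have simp_G: "simple_graph ?G" using im by (intro simple_tailed_chain) simp
  have xV: "x \<in> V" "y \<in> V" "x \<noteq> y" using xy P_V[of i] P_V[of m] disj[of i m] im by auto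
  have finV: "finite V" by (auto simp: V_def P_def finite_block)
  have simp_H: "simple_graph H"
    using simp_G finV xV by (auto simp: simple_graph_def H_def)
  show "subgraph H (add_edge ?G {x, y})"
    using simp_H V_G by (auto simp: subgraph_def add_edge_def H_def)
  have "block k i \<subseteq> V" using P_V[of i] im by (auto simp: P_def)
  then have two: "2 \<le> card (verts H)"
    using card_mono[OF finV, of "block k i"] k by (simp add: card_block H_def)
  have block_H: "edges (H_graph k a) \<subseteq> edges H" if "a \<in> {i..m}" "a \<le> t" for a
    using P_V[OF that(1)] that im by (auto simp: H_def tailed_chain_def P_def edges_H_graph)
  have rungs_H: "rungs k a \<subseteq> edges H" if "a \<in> {i..<m}" "a < t" for a
  proof -
    have "P a \<subseteq> V" "P (Suc a) \<subseteq> V" using P_V that by auto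
    then have "f \<subseteq> V" if "f \<in> rungs k a" for f
      using that \<open>a < t\<close> by (auto simp: P_def rungs_def block_def)
    moreover have "rungs k a \<subseteq> edges ?G" using that im by (auto simp: tailed_chain_def)
    ultimately show ?thesis by (auto simp: H_def)
  qed
  have fin: "finite (edges H)" using finite_edges[OF simp_H] .
  have fincut: "finite (edge_cut H S)" for S using fin edge_cut_subset by (rule finite_subset[rotated])
  have "k \<le> card (edge_cut H S)" if S: "V \<inter> S \<noteq> {}" "\<not> V \<subseteq> S" for S
  proof (cases "\<exists>a\<in>{i..m}. a \<le> t \<and> P a \<inter> S \<noteq> {} \<and> \<not> P a \<subseteq> S")
    \<comment> \<open>No part is split, so the cut follows the ring.\<close>
    case False
    define R where "R = (\<lambda>a. if a < t then rungs k a else spokes k t l)"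
    obtain b where b: "b \<in> {i..m}" "P b \<inter> S \<noteq> {}" using S(1) unfolding V_def by blast
    obtain c where c: "c \<in> {i..m}" "\<not> P c \<subseteq> S" using S(2) unfolding V_def by blast
    have whole: "P a \<subseteq> S \<or> P a \<inter> S = {}" if "a \<in> {i..m}" for a
      using False that by (cases "a \<le> t") (auto simp: P_def)
    show ?thesis
    proof (rule cyclic_chain_cut[OF k fin, where P = P and R = R and i = i and m = m and x = x and y = y])
      fix a assume a: "a \<in> {i..<m}"
      have aG: "R a \<subseteq> edges ?G" using a im l by (auto simp: R_def tailed_chain_def)
      show ends: "f \<subseteq> P a \<union> P (Suc a) \<and> f \<inter> P a \<noteq> {} \<and> f \<inter> P (Suc a) \<noteq> {}" if "f \<in> R a" for f
      proof (cases "a < t")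
        case True
        then have "P a = block k a" "P (Suc a) = block k (Suc a)" by (simp_all add: P_def)
        moreover have "f \<in> rungs k a" using \<open>f \<in> R a\<close> True by (simp add: R_def)
        then obtain j where "j \<in> {1..k+1}" "f = {U a j, U (Suc a) j}" unfolding rungs_def by blast
        ultimately show ?thesis by (simp add: block_def)
      next
        case False
        then have "a = t" using a im by auto
        then have "P a = block k t" "P (Suc a) = {W l}" by (simp_all add: P_def)
        moreover have "f \<in> spokes k t l" using \<open>f \<in> R a\<close> False by (simp add: R_def)
        then obtain u where "u \<in> block k t" "f = {W l, u}" unfolding spokes_def core_eq by blast
        ultimately show ?thesis by simp
      qed
      have "P a \<union> P (Suc a) \<subseteq> V" using P_V a by simp
      then have "f \<subseteq> V" if "f \<in> R a" for f using ends[OF that] by blast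
      then have "R a \<subseteq> edges H" using aG unfolding H_def graph.sel by blast
      moreover have "k - 1 \<le> card (R a)" using k by (simp add: R_def card_rungs card_spokes)
      ultimately show "R a \<subseteq> edges H \<and> k - 1 \<le> card (R a)" by blast
      show "{x, y} \<notin> R a" using aG xy(3) by blast
    next
      show "{x, y} \<in> edges H" by (simp add: H_def)
      show "P b \<subseteq> S" using whole b by blast
    qed (use xy disj whole b c in auto)
  next
    case True
    then obtain a where a: "a \<in> {i..m}" "a \<le> t" "P a \<inter> S \<noteq> {}" "\<not> P a \<subseteq> S"
      by blast
    then have split_a: "block k a \<inter> S \<noteq> {}" "\<not> block k a \<subseteq> S" by (simp_all add: P_def)
    have cut_a: "edge_cut (H_graph k a) S \<subseteq> edge_cut H S"
      using block_H[OF a(1,2)] by (rule edge_cut_mono)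
    \<comment> \<open>A neighbouring block; it is needed when the cut separates the poles of block \<open>a\<close>.\<close>
    obtain a' where a': "a' \<in> {i..m}" "a' \<le> t" "a' = Suc a \<or> a = Suc a'"
    proof (cases "a = i")
      case True then show ?thesis using that[of "Suc a"] im by simp
    next
      case False
      then have "a - 1 \<in> {i..m}" "a - 1 \<le> t" "a = Suc (a - 1)" using a(1,2) im(1) by auto
      then show ?thesis using that by blast
    qed
    show ?thesis
    proof (cases "U a 1 \<in> S \<longleftrightarrow> U a (k+1) \<in> S")
      case True
      then show ?thesis
        using H_graph_cut(2)[OF split_a] card_mono[OF fincut cut_a] by linarith
    next
      case False
      show ?thesis
      proof (cases "block k a' \<inter> S \<noteq> {} \<and> \<not> block k a' \<subseteq> S")
        case True
        let ?A = "edge_cut (H_graph k a) S" and ?B = "edge_cut (H_graph k a') S"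
        have cut_a': "?B \<subseteq> edge_cut H S" using block_H[OF a'(1,2)] by (rule edge_cut_mono)
        have "?A \<inter> ?B = {}"
        proof (rule ccontr)
          assume "?A \<inter> ?B \<noteq> {}"
          then obtain f where f: "f \<subseteq> block k a" "f \<subseteq> block k a'" "f \<noteq> {}"
            by (auto simp: edge_cut_def edges_H_graph)
          then have "a = a'" by (fastforce simp: block_def)
          then show False using a'(3) by simp
        qed
        then have "card (?A \<union> ?B) = card ?A + card ?B"
          using fincut cut_a cut_a' by (meson card_Un_disjoint finite_subset)
        moreover have "card (?A \<union> ?B) \<le> card (edge_cut H S)"
          using cut_a cut_a' fincut by (intro card_mono) auto
        ultimately show ?thesis
          using H_graph_cut(1)[OF split_a] H_graph_cut(1)[of k a' S] True k by linarith
      next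
        case whole: False
        \<comment> \<open>Block \<open>a'\<close> lies on one side, so the pole of block \<open>a\<close> on the other side has a cut rung.\<close>
        obtain j where j: "j \<in> {1, k+1}" "U a j \<in> S \<longleftrightarrow> \<not> block k a' \<subseteq> S"
          using False by blast
        let ?f = "{U a j, U a' j}"
        have f_rung: "?f \<in> rungs k (min a a')"
          using a'(3) j(1) k by (auto simp: rungs_def min_def insert_commute)
        have "min a a' \<in> {i..<m}" "min a a' < t" using a(1,2) a' by auto
        then have "?f \<in> edges H" using rungs_H f_rung by blast
        moreover have "U a' j \<in> block k a'" using j(1) by (auto simp: block_def)
        ultimately have "?f \<in> edge_cut H S" using whole j(2) by (auto simp: edge_cut_def)
        moreover have "?f \<notin> edge_cut (H_graph k a) S"
          using a'(3) by (auto simp: edge_cut_def edges_H_graph block_def)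
        ultimately have "Suc (card (edge_cut (H_graph k a) S)) \<le> card (edge_cut H S)"
          using card_mono[OF fincut, of "insert ?f (edge_cut (H_graph k a) S)" S] cut_a
            finite_subset[OF cut_a fincut] by simp
        then show ?thesis using H_graph_cut(1)[OF split_a] by linarith
      qed
    qed
  qed
  then show "H \<in> edge_connected_family k"
    using edge_connected_iff_cuts[OF simp_H two] by (simp add: edge_connected_family_def H_def)
qed

text \<open>
  The vertices \<open>W l\<close> are joined to the last core exactly as its two poles are, so all of them can be
  treated alike.
\<close>

lemma poles_joined_to_core:
  assumes "a \<in> {1..t}" "p \<in> {U a 1, U a (k+1)} \<or> a = t \<and> p \<in> W ` {1..r}"
  shows "p \<notin> core k a" and "u \<in> core k a \<Longrightarrow> {p, u} \<in> edges (tailed_chain k t r)"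
proof -
  show "p \<notin> core k a" using assms(2) by (auto simp: core_def)
  assume u: "u \<in> core k a"
  show "{p, u} \<in> edges (tailed_chain k t r)"
  proof (cases "p \<in> {U a 1, U a (k+1)}")
    case True
    then have "p \<noteq> u" using u by (auto simp: core_eq)
    then have "{p, u} \<in> edges (H_graph k a)"
      using True u by (auto simp: edges_H_graph core_eq block_def doubleton_eq_iff)
    then show ?thesis using assms(1) by (auto simp: tailed_chain_def)
  next
    case False
    then show ?thesis using assms(2) u by (auto simp: tailed_chain_def spokes_def)
  qed
qed

lemma missing_edge_between_poles:
  assumes k: "1 \<le> k" and a: "a \<in> {1..t}" and xy: "x \<noteq> y"
    and poles: "\<And>p. p \<in> {x, y} \<Longrightarrow> p \<in> {U a 1, U a (k+1)} \<or> a = t \<and> p \<in> W ` {1..r}"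
  shows "\<exists>H\<in>edge_connected_family k. subgraph H (add_edge (tailed_chain k t r) {x, y})"
proof (rule poles_of_core_complete[OF finite_core card_core k xy])
  let ?G = "tailed_chain k t r"
  have verts: "p \<in> verts ?G" if "p \<in> block k a \<or> a = t \<and> p \<in> W ` {1..r}" for p
    using that a by (auto simp: tailed_chain_def)
  have "p \<in> verts ?G" if "p \<in> {x, y}" for p
    using poles[OF that] verts[of p] by (auto simp: block_def)
  moreover have "core k a \<subseteq> verts ?G" using verts by (auto simp: core_eq)
  ultimately show "insert x (insert y (core k a)) \<subseteq> verts ?G" by blast
  show "x \<notin> core k a" "y \<notin> core k a"
    using poles_joined_to_core(1)[OF a poles] by blast+
  show "{x, u} \<in> edges ?G \<and> {y, u} \<in> edges ?G" if "u \<in> core k a" for u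
    using poles_joined_to_core(2)[OF a poles that] by blast
  show "{u, v} \<in> edges ?G" if "u \<in> core k a" "v \<in> core k a" "u \<noteq> v" for u v
  proof -
    have "{u, v} \<in> edges (H_graph k a)"
      using that by (auto simp: edges_H_graph core_eq doubleton_eq_iff)
    then show ?thesis using a by (auto simp: tailed_chain_def)
  qed
qed

text \<open>
  The position in the chain, with the pendant vertices placed just beyond the last block. It serves
  to order the two ends of a missing edge.
\<close>

fun level :: "nat \<Rightarrow> vertex \<Rightarrow> nat" where
  "level t (U a j) = a"
| "level t (W l) = Suc t"

lemma missing_edge_closes:
  assumes k: "3 \<le> k" and t: "1 \<le> t"
    and xy: "x \<in> verts (tailed_chain k t r)" "y \<in> verts (tailed_chain k t r)" "x \<noteq> y"
      "{x, y} \<notin> edges (tailed_chain k t r)"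
    and lev: "level t x \<le> level t y"
  shows "\<exists>H\<in>edge_connected_family k. subgraph H (add_edge (tailed_chain k t r) {x, y})"
proof (cases y)
  case y: (U b j)
  then obtain a i where x: "x = U a i" using xy(2) lev by (cases x) (auto simp: tailed_chain_def block_def)
  have mem: "a \<in> {1..t}" "b \<in> {1..t}" "x \<in> block k a" "y \<in> block k b"
    using xy(1,2) x y by (auto simp: tailed_chain_def block_def)
  show ?thesis
  proof (cases "a = b")
    case True
    have "{x, y} \<notin> edges (H_graph k a)" using xy(4) mem(1) by (auto simp: tailed_chain_def)
    then have "{x, y} = {U a 1, U a (k+1)}" using xy(3) mem True by (auto simp: edges_H_graph)
    then show ?thesis
      using k xy(3) by (intro missing_edge_between_poles[OF _ mem(1)]) auto
  next
    case False
    then show ?thesis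
      using k xy(4) mem lev x y
      by (intro missing_edge_closes_chain[OF refl, where i = a and m = b and l = 0]) auto
  qed
next
  case y: (W l)
  then have l: "l \<in> {1..r}" using xy(2) by (auto simp: tailed_chain_def block_def)
  show ?thesis
  proof (cases "level t x < t")
    case True
    then obtain a i where x: "x = U a i" by (cases x) auto
    then have "a \<in> {1..t}" "x \<in> block k a" using xy(1) by (auto simp: tailed_chain_def block_def)
    then show ?thesis
      using k xy(4) True x y l
      by (intro missing_edge_closes_chain[OF refl, where i = a and m = "Suc t" and l = l]) auto
  next
    case False
    have "x \<notin> core k t"
      using xy(4) y l by (auto simp: tailed_chain_def spokes_def insert_commute)
    then have "x \<in> {U t 1, U t (k+1)} \<or> x \<in> W ` {1..r}"
      using xy(1) False by (auto simp: tailed_chain_def core_eq block_def)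
    then show ?thesis
      using k t xy(3) y l by (intro missing_edge_between_poles[of k t]) auto
  qed
qed

lemma saturated_tailed_chain:
  assumes k: "3 \<le> k" and t: "1 \<le> t"
  shows "saturated (edge_connected_family k) (tailed_chain k t r)"
  unfolding saturated_def
proof (intro conjI ballI)
  let ?G = "tailed_chain k t r"
  show "simple_graph ?G" using t by (rule simple_tailed_chain)
  show "\<not> (\<exists>H\<in>edge_connected_family k. subgraph H ?G)"
    using tailed_chain_no_edge_connected_subgraph[OF k] by (auto simp: edge_connected_family_def)
  fix e assume "e \<in> edges (complement ?G)"
  then have e: "e \<subseteq> verts ?G" "card e = 2" "e \<notin> edges ?G"
    by (auto simp: complement_def complete_graph_def)
  then obtain x y where xy: "e = {x, y}" "x \<noteq> y" by (auto simp: card_2_iff)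
  show "\<exists>H\<in>edge_connected_family k. subgraph H (add_edge ?G e)"
  proof (cases "level t x \<le> level t y")
    case True
    then show ?thesis using missing_edge_closes[OF k t, of x r y] e xy by simp
  next
    case False
    then show ?thesis
      using missing_edge_closes[OF k t, of y r x] e xy by (simp add: insert_commute)
  qed
qed

theorem proposition2p2:
  fixes k n :: nat
  assumes "3 \<le> k" and "k < n"
  shows "saturated (edge_connected_family k) (G_graph k n) \<and>
         card (verts (G_graph k n)) = n \<and>
         int (card (edges (G_graph k n))) = rho k n"
proof -
  have "1 \<le> n div (k+1)" using assms(2) by (simp add: Suc_le_eq div_greater_zero_iff)
  then show ?thesis
    using saturated_tailed_chain[OF assms(1)] card_verts_tailed_chain
      card_edges_tailed_chain[OF assms(1)] edge_count_eq_rho[OF assms]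
    unfolding G_graph_eq by (metis div_mult_mod_eq)
qed

end
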